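(* Let $\{P_{u,b}\}_{u\in\mathcal U,\,b\in B_u}$ be a measurement setting family on $\mathcal H=(\mathbb C^2)^{\otimes n}$ and let $O=|\psi\rangle\langle\psi|$ with $|\psi\rangle\in\mathcal H$ a unit vector. For a family $\alpha=(\alpha_{u,b})$ of real coefficients define $$L(\alpha)=\sum_{u\in\mathcal U}\max_{b\in B_u}|\alpha_{u,b}| .$$ For every real coefficient family $\alpha$ satisfying $\sum_{u,b}\alpha_{u,b}P_{u,b}=O$, there exists a probability distribution $q_\alpha$ on $\mathcal U$ such that $(q_\alpha,\alpha)$ is admissible and the one-shot estimator $X$ corresponding to $(q_\alpha,\alpha)$ satisfies $$\sup_{\rho}\operatorname{Var}_\rho(X)\le L(\alpha)^2 ,$$ the supremum being over all density operators $\rho$ on $\mathcal H$. Consequently, $$\Gamma^\star(O):=\inf_{(q,\alpha)\ \text{admissible}}\ \sup_{\rho}\operatorname{Var}_\rho(X)\ \le\ \inf_{\alpha:\ \sum_{u,b}\alpha_{u,b}P_{u,b}=O}L(\alpha)^2 .$$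
   Context: $\mathcal H=(\mathbb C^2)^{\otimes n}$ is the $n$-qubit Hilbert space. A density operator (state) is an operator $\rho\succeq0$ on $\mathcal H$ with $\operatorname{tr}(\rho)=1$. A measurement setting family is a finite collection of operators $P_{u,b}\succeq 0$ on $\mathcal H$, indexed by settings $u\in\mathcal U$ and outcomes $b\in B_u$ (finite sets), such that $\sum_{b\in B_u}P_{u,b}=I$ for each $u\in\mathcal U$. An admissible pair $(q,\alpha)$ for $O$ consists of a probability distribution $q$ on $\mathcal U$ and real numbers $\alpha_{u,b}$ ($u\in\mathcal U$, $b\in B_u$) such that $\alpha_{u,b}=0$ for all $b\in B_u$ whenever $q(u)=0$, and $\sum_{u,b}\alpha_{u,b}P_{u,b}=O$ (the unbiasedness identity). The one-shot estimator corresponding to an admissible $(q,\alpha)$: when the state is $\rho$, sample $u$ from $q$, then obtain outcome $b\in B_u$ with probability $\operatorname{tr}(\rho P_{u,b})$, and output $X=\alpha_{u,b}/q(u)$. $\operatorname{Var}_\rho(X)$ is the variance of $X$ under this procedure. An infimum over an empty set is $+\infty$. *)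

theory Defs
  imports "HOL-Probability.Probability"
begin

text \<open>
  The type variable \<open>'n\<close> indexes the qubits, so \<open>n = CARD('n)\<close>. The space \<open>(\<complex>\<^sup>2)\<^sup>\<otimes>\<^sup>n\<close> is
  represented in its computational basis, which is indexed by the bit strings of
  type \<open>bool ^ 'n\<close>; operators are matrices over this basis.
\<close>

type_synonym 'n qvec = "complex ^ (bool ^ 'n)"
type_synonym 'n qop = "complex ^ (bool ^ 'n) ^ (bool ^ 'n)"

definition cinner :: "'n::finite qvec \<Rightarrow> 'n qvec \<Rightarrow> complex" where
  "cinner v w = (\<Sum>i\<in>UNIV. cnj (v $ i) * w $ i)"

definition ketbra :: "'n::finite qvec \<Rightarrow> 'n qop" where
  "ketbra v = (\<chi> i j. v $ i * cnj (v $ j))"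

text \<open>
  Membership in \<open>\<real>\<^sub>\<ge>\<^sub>0\<close> asserts that the quadratic form is real as well as nonnegative.
  Over \<open>\<complex>\<close>, real values of the form already force the matrix to be Hermitian.
\<close>

definition psd :: "'n::finite qop \<Rightarrow> bool" where
  "psd A \<longleftrightarrow> (\<forall>v. cinner v (A *v v) \<in> \<real>\<^sub>\<ge>\<^sub>0)"

definition density_operators :: "'n::finite qop set" where
  "density_operators = {\<rho>. psd \<rho> \<and> trace \<rho> = 1}"

definition measurement_family ::
    "'u set \<Rightarrow> ('u \<Rightarrow> 'b set) \<Rightarrow> ('u \<Rightarrow> 'b \<Rightarrow> 'n::finite qop) \<Rightarrow> bool" where
  "measurement_family U B P \<longleftrightarrow>
     finite U \<and>
     (\<forall>u\<in>U. finite (B u)) \<and>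
     (\<forall>u\<in>U. \<forall>b\<in>B u. psd (P u b)) \<and>
     (\<forall>u\<in>U. (\<Sum>b\<in>B u. P u b) = mat 1)"

definition unbiased ::
    "'u set \<Rightarrow> ('u \<Rightarrow> 'b set) \<Rightarrow> ('u \<Rightarrow> 'b \<Rightarrow> 'n::finite qop) \<Rightarrow> 'n qop \<Rightarrow>
     ('u \<Rightarrow> 'b \<Rightarrow> real) \<Rightarrow> bool" where
  "unbiased U B P Ob \<alpha> \<longleftrightarrow> (\<Sum>u\<in>U. \<Sum>b\<in>B u. \<alpha> u b *\<^sub>R P u b) = Ob"

definition admissible ::
    "'u set \<Rightarrow> ('u \<Rightarrow> 'b set) \<Rightarrow> ('u \<Rightarrow> 'b \<Rightarrow> 'n::finite qop) \<Rightarrow> 'n qop \<Rightarrow>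
     'u pmf \<Rightarrow> ('u \<Rightarrow> 'b \<Rightarrow> real) \<Rightarrow> bool" where
  "admissible U B P Ob q \<alpha> \<longleftrightarrow>
     set_pmf q \<subseteq> U \<and>
     (\<forall>u\<in>U. pmf q u = 0 \<longrightarrow> (\<forall>b\<in>B u. \<alpha> u b = 0)) \<and>
     unbiased U B P Ob \<alpha>"

text \<open>
  For \<open>u \<in> U\<close>, a measurement family and a density operator \<open>\<rho>\<close>, the numbers
  \<open>tr (\<rho> P\<^sub>u\<^sub>b)\<close> are real, nonnegative and sum to \<open>1\<close> over \<open>b \<in> B u\<close>. Hence
  \<^const>\<open>Re\<close> loses nothing and \<^const>\<open>embed_pmf\<close> yields the distribution with these
  probabilities; it is unspecified for other arguments.
\<close>

definition outcome_pmf ::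
    "('u \<Rightarrow> 'b set) \<Rightarrow> ('u \<Rightarrow> 'b \<Rightarrow> 'n::finite qop) \<Rightarrow> 'n qop \<Rightarrow> 'u \<Rightarrow> 'b pmf" where
  "outcome_pmf B P \<rho> u =
     embed_pmf (\<lambda>b. if b \<in> B u then Re (trace (\<rho> ** P u b)) else 0)"

definition sampling_pmf ::
    "('u \<Rightarrow> 'b set) \<Rightarrow> ('u \<Rightarrow> 'b \<Rightarrow> 'n::finite qop) \<Rightarrow> 'u pmf \<Rightarrow> 'n qop \<Rightarrow> ('u \<times> 'b) pmf" where
  "sampling_pmf B P q \<rho> =
     bind_pmf q (\<lambda>u. map_pmf (\<lambda>b. (u, b)) (outcome_pmf B P \<rho> u))"

definition estimator :: "'u pmf \<Rightarrow> ('u \<Rightarrow> 'b \<Rightarrow> real) \<Rightarrow> 'u \<times> 'b \<Rightarrow> real" where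
  "estimator q \<alpha> = (\<lambda>(u, b). \<alpha> u b / pmf q u)"

definition estimator_variance ::
    "('u \<Rightarrow> 'b set) \<Rightarrow> ('u \<Rightarrow> 'b \<Rightarrow> 'n::finite qop) \<Rightarrow> 'u pmf \<Rightarrow> ('u \<Rightarrow> 'b \<Rightarrow> real) \<Rightarrow>
     'n qop \<Rightarrow> real" where
  "estimator_variance B P q \<alpha> \<rho> =
     measure_pmf.variance (sampling_pmf B P q \<rho>) (estimator q \<alpha>)"

text \<open>
  Suprema and infima are taken in \<^typ>\<open>ereal\<close>, where the infimum over the empty set
  is \<open>\<infinity>\<close>.
\<close>

definition worst_variance ::
    "('u \<Rightarrow> 'b set) \<Rightarrow> ('u \<Rightarrow> 'b \<Rightarrow> 'n::finite qop) \<Rightarrow> 'u pmf \<Rightarrow> ('u \<Rightarrow> 'b \<Rightarrow> real) \<Rightarrow> ereal" where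
  "worst_variance B P q \<alpha> =
     (SUP \<rho>\<in>density_operators. ereal (estimator_variance B P q \<alpha> \<rho>))"

definition Gamma_star ::
    "'u set \<Rightarrow> ('u \<Rightarrow> 'b set) \<Rightarrow> ('u \<Rightarrow> 'b \<Rightarrow> 'n::finite qop) \<Rightarrow> 'n qop \<Rightarrow> ereal" where
  "Gamma_star U B P Ob =
     (INF (q, \<alpha>)\<in>{(q, \<alpha>). admissible U B P Ob q \<alpha>}. worst_variance B P q \<alpha>)"

definition L_cost :: "'u set \<Rightarrow> ('u \<Rightarrow> 'b set) \<Rightarrow> ('u \<Rightarrow> 'b \<Rightarrow> real) \<Rightarrow> real" where
  "L_cost U B \<alpha> = (\<Sum>u\<in>U. Max ((\<lambda>b. \<bar>\<alpha> u b\<bar>) ` B u))"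

end

theory Submission
  imports Defs
begin

text \<open>
  Sample \<open>u\<close> with probability proportional to \<open>m u = max\<^sub>b \<bar>\<alpha> u b\<bar>\<close>. The normalising constant is
  \<open>L(\<alpha>)\<close>, so the estimator \<open>\<alpha> u b / q u\<close> is bounded by \<open>L(\<alpha>)\<close> on the support of the sampling
  distribution, and its variance is at most its second moment.  That the outcome probabilities
  form a distribution rests on \<open>tr (A B) \<ge> 0\<close> for positive semidefinite \<open>A\<close> and \<open>B\<close>, which is
  obtained by stripping rank-one summands off \<open>A\<close> as in the Cholesky decomposition.
\<close>

section \<open>Sesquilinear form and rank-one matrices\<close>

lemma cinner_add_left: "cinner (x + y) z = cinner x z + cinner y z"
  by (simp add: cinner_def algebra_simps sum.distrib)

lemma cinner_add_right: "cinner x (y + z) = cinner x y + cinner x z"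
  by (simp add: cinner_def algebra_simps sum.distrib)

lemma cinner_diff_right: "cinner x (y - z) = cinner x y - cinner x z"
  by (simp add: cinner_def algebra_simps sum_subtractf)

lemma cinner_scale_left: "cinner (c *s x) y = cnj c * cinner x y"
  by (simp add: cinner_def sum_distrib_left mult_ac)

lemma cinner_scale_right: "cinner x (c *s y) = c * cinner x y"
  by (simp add: cinner_def sum_distrib_left mult_ac)

lemma cinner_axis_left: "cinner (axis i 1) y = y $ i"
proof -
  have "cinner (axis i 1) y = (\<Sum>j\<in>UNIV. if j = i then y $ j else 0)"
    unfolding cinner_def by (rule sum.cong) (auto simp: axis_def)
  then show ?thesis by simp
qed

lemma cnj_cinner: "cnj (cinner x y) = cinner y x"
  by (simp add: cinner_def mult.commute)

lemma matrix_vector_mult_axis_component: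
  fixes A :: "'n::finite qop"
  shows "(A *v axis j 1) $ i = A $ i $ j"
  by (simp add: matrix_vector_mult_def axis_def if_distrib cong: if_cong)

lemma ketbra_mult_vec: "ketbra v *v x = cinner v x *s v"
  by (simp add: vec_eq_iff ketbra_def matrix_vector_mult_def cinner_def sum_distrib_left
      sum_distrib_right mult_ac)

text \<open>Turns each rank-one summand of a matrix, traced against \<open>A\<close>, into a value
  of the form of \<open>A\<close>; for psd \<open>A\<close> that value is nonnegative.\<close>

lemma trace_ketbra_mult: "trace (ketbra v ** A) = cinner v (A *v v)"
proof -
  have "trace (ketbra v ** A) = (\<Sum>i\<in>UNIV. \<Sum>j\<in>UNIV. v $ i * cnj (v $ j) * A $ j $ i)"
    by (simp add: trace_def matrix_matrix_mult_def ketbra_def)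
  also have "\<dots> = (\<Sum>j\<in>UNIV. \<Sum>i\<in>UNIV. v $ i * cnj (v $ j) * A $ j $ i)"
    by (rule sum.swap)
  also have "\<dots> = cinner v (A *v v)"
    by (simp add: cinner_def matrix_vector_mult_def sum_distrib_left mult_ac)
  finally show ?thesis .
qed

lemma ketbra_nonzero:
  assumes "v \<noteq> 0"
  shows "ketbra v \<noteq> 0"
proof
  assume *: "ketbra v = 0"
  from assms obtain i where "v $ i \<noteq> 0" by (auto simp: vec_eq_iff)
  moreover have "ketbra v $ i $ i = 0" using * by simp
  ultimately show False by (simp add: ketbra_def)
qed

section \<open>Positive semidefinite matrices\<close>

lemma psd_form:
  assumes "psd A"
  shows "Re (cinner x (A *v x)) \<ge> 0" "Im (cinner x (A *v x)) = 0"
  using assms by (auto simp: psd_def complex_nonneg_Reals_iff)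

lemma psd_diag:
  assumes "psd A"
  shows "Re (A $ i $ i) \<ge> 0" "Im (A $ i $ i) = 0"
  using psd_form[OF assms, of "axis i 1"]
  by (simp_all add: cinner_axis_left matrix_vector_mult_axis_component)

text \<open>The two cross terms stay separate because \<open>A\<close> is not assumed Hermitian: the
  expansion is itself used to prove that psd matrices are Hermitian, and later to complete the
  square.\<close>

lemma form_add_axis:
  fixes A :: "'n::finite qop"
  shows "cinner (x + c *s axis i 1) (A *v (x + c *s axis i 1)) =
    cinner x (A *v x) + c * cinner x (A *v axis i 1) + cnj c * (A *v x) $ i
      + cnj c * c * A $ i $ i"
  by (simp add: matrix_vector_right_distrib vector_scalar_commute cinner_add_left cinner_add_right
      cinner_scale_left cinner_scale_right cinner_axis_left matrix_vector_mult_axis_component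
      algebra_simps)

lemma form_axis_pair:
  fixes A :: "'n::finite qop"
  shows "cinner (axis i 1 + c *s axis j 1) (A *v (axis i 1 + c *s axis j 1)) =
    A $ i $ i + c * A $ i $ j + cnj c * A $ j $ i + cnj c * c * A $ j $ j"
  by (simp add: form_add_axis cinner_axis_left matrix_vector_mult_axis_component)

text \<open>Polarisation: the form is real at \<open>axis i 1 + c *s axis j 1\<close> and the
  diagonal is real, so the cross terms have imaginary part zero. Taking \<open>c = \<i>\<close>
  compares the real parts of the two entries, \<open>c = 1\<close> their imaginary parts.\<close>

lemma psd_hermitian:
  assumes "psd A"
  shows "A $ j $ i = cnj (A $ i $ j)"
proof (rule complex_eqI)
  note d = psd_diag(2)[OF assms]
  show "Re (A $ j $ i) = Re (cnj (A $ i $ j))"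
    using psd_form(2)[OF assms, of "axis i 1 + \<i> *s axis j 1"] d[of i] d[of j]
    unfolding form_axis_pair by simp
  show "Im (A $ j $ i) = Im (cnj (A $ i $ j))"
    using psd_form(2)[OF assms, of "axis i 1 + 1 *s axis j 1"] d[of i] d[of j]
    unfolding form_axis_pair by simp
qed

text \<open>Without diagonal terms the form at \<open>axis i 1 + c *s axis j 1\<close> is twice the
  real part of \<open>c * A $ i $ j\<close>. Choosing \<open>c\<close> as minus the conjugate of
  that entry makes it -2 times the squared modulus, which must be nonnegative.\<close>

lemma psd_zero_diag:
  assumes "psd A" and diag: "\<And>i. A $ i $ i = 0"
  shows "A = 0"
proof -
  have "A $ i $ j = 0" for i j
  proof -
    define z where "z = A $ i $ j"
    have "0 \<le> Re (A $ i $ i + (- cnj z) * A $ i $ j + cnj (- cnj z) * A $ j $ i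
        + cnj (- cnj z) * (- cnj z) * A $ j $ j)"
      using psd_form(1)[OF assms(1), of "axis i 1 + (- cnj z) *s axis j 1"]
      unfolding form_axis_pair .
    also have "\<dots> = - 2 * ((Re z)\<^sup>2 + (Im z)\<^sup>2)"
      using psd_hermitian[OF assms(1), of j i]
      by (simp add: diag z_def[symmetric] power2_eq_square)
    finally have "(Re z)\<^sup>2 + (Im z)\<^sup>2 = 0"
      by (smt (verit) zero_le_power2)
    then show ?thesis
      by (simp add: z_def complex_eq_iff sum_power2_eq_zero_iff)
  qed
  then show ?thesis by (simp add: vec_eq_iff)
qed

text \<open>The rank-one matrix of the pivot column is the Schur complement correction: subtracting it
  evaluates the form of \<open>A\<close> at the point that completes the square in coordinate \<open>i\<close>.\<close>

lemma psd_minus_pivot: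
  fixes A :: "'n::finite qop"
  assumes "psd A" and a: "Re (A $ i $ i) = a" "a > 0"
  defines "v \<equiv> complex_of_real (1 / sqrt a) *s column i A"
  shows "psd (A - ketbra v)"
  unfolding psd_def
proof
  fix x
  define z where "z = cinner (axis i 1) (A *v x)"
  define y where "y = x + (- z / of_real a) *s axis i 1"
  have Aii: "A $ i $ i = of_real a"
    using a psd_diag(2)[OF assms(1), of i] by (simp add: complex_eq_iff)
  have z: "(A *v x) $ i = z"
    by (simp add: z_def cinner_axis_left)
  have col: "A *v axis i 1 = column i A"
    by (simp add: vec_eq_iff matrix_vector_mult_axis_component column_def)
  have colx: "cinner (column i A) x = z"
    unfolding z[symmetric] cinner_def matrix_vector_mult_def column_def
    by (simp add: psd_hermitian[OF assms(1), of _ i])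
  have xcol: "cinner x (column i A) = cnj z"
    using colx cnj_cinner by metis
  have sq: "complex_of_real (sqrt a) * complex_of_real (sqrt a) = of_real a"
    using a by (metis of_real_mult real_sqrt_mult_self abs_of_pos)
  \<comment> \<open>With coefficient \<open>- z / of_real a\<close>, each cross term contributes
    -|z|^2/a and the quadratic term +|z|^2/a, leaving exactly the amount that
    \<open>ketbra v\<close> removes.\<close>
  have "cinner y (A *v y) = cinner x (A *v x) - z * cnj z / of_real a"
    using a unfolding y_def form_add_axis z Aii col xcol by (simp add: field_simps)
  moreover have "cinner x (ketbra v *v x) = z * cnj z / of_real a"
    unfolding ketbra_mult_vec v_def
    by (simp add: cinner_scale_left cinner_scale_right colx xcol sq)
  ultimately have "cinner x ((A - ketbra v) *v x) = cinner y (A *v y)"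
    by (simp add: matrix_vector_mult_diff_rdistrib cinner_diff_right)
  then show "cinner x ((A - ketbra v) *v x) \<in> \<real>\<^sub>\<ge>\<^sub>0"
    using assms(1) by (simp add: psd_def)
qed

text \<open>Induction on the number of nonzero diagonal entries of \<open>A\<close>. With none left
  \<open>A\<close> vanishes; otherwise removing a pivot column's rank-one matrix lowers the count,
  and the removed part contributes the value of the form of \<open>C\<close> at
  \<open>v\<close>.\<close>

lemma trace_mult_psd_nonneg:
  fixes A C :: "'n::finite qop"
  assumes "psd A" "psd C"
  shows "Re (trace (A ** C)) \<ge> 0"
  using assms(1)
proof (induction "card {i. A $ i $ i \<noteq> 0}" arbitrary: A rule: less_induct)
  case less
  show ?case
  proof (cases "\<forall>i. A $ i $ i = 0")
    case True
    then have "A = 0" using psd_zero_diag less.prems by blast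
    then show ?thesis by (simp add: trace_def matrix_matrix_mult_def)
  next
    case False
    then obtain i where i: "A $ i $ i \<noteq> 0" by blast
    define a where "a = Re (A $ i $ i)"
    have Aii: "A $ i $ i = of_real a"
      using psd_diag(2)[OF less.prems, of i] by (simp add: complex_eq_iff a_def)
    have a: "a > 0"
      using i psd_diag(1)[OF less.prems, of i] Aii by (auto simp: order_less_le)
    define v where "v = complex_of_real (1 / sqrt a) *s column i A"
    define A' where "A' = A - ketbra v"
    have psd': "psd A'"
      unfolding A'_def v_def using psd_minus_pivot[OF less.prems a_def[symmetric] a] .
    have diag': "A' $ k $ k = A $ k $ k - of_real ((cmod (v $ k))\<^sup>2)" for k
      by (simp add: A'_def ketbra_def complex_norm_square del: of_real_power)
    \<comment> \<open>Subtracting \<open>ketbra v\<close> only lowers diagonal entries, and those of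
      the psd matrix \<open>A'\<close> cannot be negative, so zeros persist. Since the pivot becomes
      zero as well, the count strictly drops.\<close>
    have zero: "A' $ k $ k = 0" if "A $ k $ k = 0" for k
    proof -
      have "Re (A' $ k $ k) \<ge> 0" using psd_diag(1)[OF psd'] .
      then have "(cmod (v $ k))\<^sup>2 \<le> 0" by (simp only: diag' that) simp
      then show ?thesis by (simp add: diag' that)
    qed
    have "v $ i = complex_of_real (1 / sqrt a * a)"
      by (simp add: v_def column_def Aii)
    also have "1 / sqrt a * a = sqrt a"
      using a by (simp add: real_div_sqrt)
    finally have vi: "v $ i = of_real (sqrt a)" .
    have "A' $ i $ i = 0"
      using a unfolding diag' vi Aii by (simp del: of_real_power)
    with zero i have "{k. A' $ k $ k \<noteq> 0} \<subset> {k. A $ k $ k \<noteq> 0}" by blast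
    then have "card {k. A' $ k $ k \<noteq> 0} < card {k. A $ k $ k \<noteq> 0}"
      by (intro psubset_card_mono) auto
    from less.hyps[OF this psd'] have IH: "Re (trace (A' ** C)) \<ge> 0" .
    have "A ** C = A' ** C + ketbra v ** C"
      by (simp add: A'_def vec_eq_iff matrix_matrix_mult_def algebra_simps flip: sum.distrib)
    then have "trace (A ** C) = trace (A' ** C) + cinner v (C *v v)"
      by (simp add: trace_add trace_ketbra_mult)
    then show ?thesis using IH psd_form(1)[OF assms(2), of v] by simp
  qed
qed

section \<open>Outcome distributions\<close>

lemma trace_sum: "trace (\<Sum>b\<in>S. F b) = (\<Sum>b\<in>S. trace (F b))"
  unfolding trace_def sum_component by (rule sum.swap)

lemma matrix_mult_sum_right:
  fixes A :: "'n::finite qop"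
  shows "A ** (\<Sum>b\<in>S. F b) = (\<Sum>b\<in>S. A ** F b)"
proof -
  have "A ** 0 = 0" by (simp add: vec_eq_iff matrix_matrix_mult_def)
  then show ?thesis
    by (induction S rule: infinite_finite_induct) (simp_all add: matrix_add_ldistrib)
qed

text \<open>Serves both the outcome distribution of a setting and the distribution over settings;
  the finite support reduces the normalisation integral to a sum.\<close>

lemma embed_finite_pmf:
  fixes p :: "'a \<Rightarrow> real"
  assumes "finite S" and nonneg: "\<And>x. x \<in> S \<Longrightarrow> p x \<ge> 0" and "sum p S = 1"
  shows "pmf (embed_pmf (\<lambda>x. if x \<in> S then p x else 0)) x = (if x \<in> S then p x else 0)"
proof (rule pmf_embed_pmf)
  show "0 \<le> (if x \<in> S then p x else 0)" for x using nonneg by simp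
  have "(\<integral>\<^sup>+ x. ennreal (if x \<in> S then p x else 0) \<partial>count_space UNIV) =
      (\<Sum>x\<in>S. ennreal (if x \<in> S then p x else 0))"
    using assms(1) by (intro nn_integral_count_space') (auto split: if_splits)
  also have "\<dots> = (\<Sum>x\<in>S. ennreal (p x))" by simp
  also have "\<dots> = ennreal (sum p S)" using nonneg by (intro sum_ennreal) auto
  finally show "(\<integral>\<^sup>+ x. ennreal (if x \<in> S then p x else 0) \<partial>count_space UNIV) = 1"
    using assms(3) by simp
qed

text \<open>The later variance bound needs only the support of the outcome distribution.
  Nonnegativity comes from \<open>trace_mult_psd_nonneg\<close>, and total mass 1 from the
  resolution of the identity and the unit trace of \<open>\<rho>\<close>.\<close>

lemma set_outcome_pmf:
  assumes "measurement_family U B P" "\<rho> \<in> density_operators" "u \<in> U"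
  shows "set_pmf (outcome_pmf B P \<rho> u) \<subseteq> B u"
proof -
  have fin: "finite (B u)" and sum1: "(\<Sum>b\<in>B u. P u b) = mat 1"
    and psdP: "\<And>b. b \<in> B u \<Longrightarrow> psd (P u b)"
    using assms by (auto simp: measurement_family_def)
  have \<rho>: "psd \<rho>" "trace \<rho> = 1" using assms(2) by (auto simp: density_operators_def)
  have "(\<Sum>b\<in>B u. Re (trace (\<rho> ** P u b))) = Re (trace (\<rho> ** (\<Sum>b\<in>B u. P u b)))"
    by (simp add: matrix_mult_sum_right trace_sum)
  also have "\<dots> = 1" by (simp add: sum1 \<rho>)
  finally have "pmf (outcome_pmf B P \<rho> u) b =
      (if b \<in> B u then Re (trace (\<rho> ** P u b)) else 0)" for b
    unfolding outcome_pmf_def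
    using trace_mult_psd_nonneg[OF \<rho>(1) psdP] by (intro embed_finite_pmf[OF fin]) auto
  then show ?thesis by (auto simp: set_pmf_eq split: if_splits)
qed

section \<open>Variance bounds\<close>

lemma variance_pmf_le_square_bound:
  fixes X :: "'a \<Rightarrow> real"
  assumes bound: "\<And>x. x \<in> set_pmf p \<Longrightarrow> \<bar>X x\<bar> \<le> c"
  shows "measure_pmf.variance p X \<le> c\<^sup>2"
proof -
  have sq: "(X x)\<^sup>2 \<le> c\<^sup>2" if "x \<in> set_pmf p" for x
    using power_mono[OF bound[OF that], of 2] by simp
  have int: "integrable (measure_pmf p) X"
    by (rule measure_pmf.integrable_const_bound[where B = c])
      (use bound in \<open>auto simp: AE_measure_pmf_iff\<close>)
  have int2: "integrable (measure_pmf p) (\<lambda>x. (X x)\<^sup>2)"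
    by (rule measure_pmf.integrable_const_bound[where B = "c\<^sup>2"])
      (use sq in \<open>auto simp: AE_measure_pmf_iff\<close>)
  have "measure_pmf.variance p X \<le> measure_pmf.expectation p (\<lambda>x. (X x)\<^sup>2)"
    by (subst measure_pmf.variance_eq[OF int int2]) simp
  also have "\<dots> \<le> c\<^sup>2"
    using int2 by (rule measure_pmf.integral_le_const) (use sq in \<open>auto simp: AE_measure_pmf_iff\<close>)
  finally show ?thesis .
qed

text \<open>Every sampled setting has positive probability, so dividing the hypothesis by
  \<open>pmf q u\<close> bounds the estimator by \<open>c\<close> on the sampling support, for every
  state at once.\<close>

lemma worst_variance_le_square_bound:
  fixes P :: "'u \<Rightarrow> 'b \<Rightarrow> 'n::finite qop"
  assumes "measurement_family U B P" "set_pmf q \<subseteq> U"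
    and bound: "\<And>u b. u \<in> set_pmf q \<Longrightarrow> b \<in> B u \<Longrightarrow> \<bar>\<alpha> u b\<bar> \<le> c * pmf q u"
  shows "worst_variance B P q \<alpha> \<le> ereal (c\<^sup>2)"
  unfolding worst_variance_def
proof (rule SUP_least)
  fix \<rho> :: "'n qop" assume \<rho>: "\<rho> \<in> density_operators"
  have "\<bar>estimator q \<alpha> x\<bar> \<le> c" if "x \<in> set_pmf (sampling_pmf B P q \<rho>)" for x
  proof -
    from that obtain u b where x: "x = (u, b)" "u \<in> set_pmf q"
      and "b \<in> set_pmf (outcome_pmf B P \<rho> u)"
      by (auto simp: sampling_pmf_def)
    then have "b \<in> B u" using set_outcome_pmf[OF assms(1) \<rho>] assms(2) by blast
    then have "\<bar>\<alpha> u b\<bar> \<le> c * pmf q u" using bound x by blast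
    moreover have "pmf q u > 0" using x by (simp add: pmf_positive_iff)
    ultimately show ?thesis by (simp add: x estimator_def field_simps)
  qed
  then have "estimator_variance B P q \<alpha> \<rho> \<le> c\<^sup>2"
    unfolding estimator_variance_def by (rule variance_pmf_le_square_bound)
  then show "ereal (estimator_variance B P q \<alpha> \<rho>) \<le> ereal (c\<^sup>2)" by simp
qed

text \<open>The assumption \<open>Ob \<noteq> 0\<close> keeps the normalising constant positive, so
  that \<open>m u / L\<close> defines a distribution.\<close>

lemma exists_admissible_worst_variance_le:
  fixes P :: "'u \<Rightarrow> 'b \<Rightarrow> 'n::finite qop"
  assumes fam: "measurement_family U B P" and unb: "unbiased U B P Ob \<alpha>" and "Ob \<noteq> 0"
  shows "\<exists>q. admissible U B P Ob q \<alpha> \<and> worst_variance B P q \<alpha> \<le> ereal ((L_cost U B \<alpha>)\<^sup>2)"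
proof -
  define m where "m u = Max ((\<lambda>b. \<bar>\<alpha> u b\<bar>) ` B u)" for u
  define L where "L = L_cost U B \<alpha>"
  have finU: "finite U" and finB: "\<And>u. u \<in> U \<Longrightarrow> finite (B u)"
    using fam by (auto simp: measurement_family_def)
  have le_m: "\<bar>\<alpha> u b\<bar> \<le> m u" if "u \<in> U" "b \<in> B u" for u b
    unfolding m_def using that finB by (intro Max_ge) auto
  have m_nonneg: "m u \<ge> 0" if "u \<in> U" for u
  proof -
    \<comment> \<open>\<open>B u\<close> is nonempty because its operators sum to the nonzero
      identity; \<open>Max\<close> of an empty set would be unspecified and might be
      negative.\<close>
    have "(mat 1 :: 'n qop) $ i $ i \<noteq> 0" for i by (simp add: mat_def)
    then have "(mat 1 :: 'n qop) \<noteq> 0" by (metis zero_index)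
    moreover have "(\<Sum>b\<in>B u. P u b) = mat 1"
      using fam that by (auto simp: measurement_family_def)
    ultimately obtain b where "b \<in> B u" by (metis sum.empty all_not_in_conv)
    then show ?thesis using le_m[OF that] by (meson abs_ge_zero order_trans)
  qed
  have L_eq: "L = sum m U" by (simp add: L_def L_cost_def m_def)
  have "L \<noteq> 0"
  proof
    assume "L = 0"
    then have "m u = 0" if "u \<in> U" for u
      using that m_nonneg finU by (simp add: L_eq sum_nonneg_eq_0_iff)
    then have "\<alpha> u b = 0" if "u \<in> U" "b \<in> B u" for u b
      using le_m that by fastforce
    then have "(\<Sum>u\<in>U. \<Sum>b\<in>B u. \<alpha> u b *\<^sub>R P u b) = 0" by simp
    then show False using unb \<open>Ob \<noteq> 0\<close> by (simp add: unbiased_def)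
  qed
  moreover have "L \<ge> 0" unfolding L_eq using m_nonneg by (rule sum_nonneg)
  ultimately have "L > 0" by simp
  define q where "q = embed_pmf (\<lambda>u. if u \<in> U then m u / L else 0)"
  have pmf_q: "pmf q u = (if u \<in> U then m u / L else 0)" for u
    unfolding q_def
    using finU m_nonneg \<open>L > 0\<close>
    by (intro embed_finite_pmf) (auto simp: L_eq simp flip: sum_divide_distrib)
  have setq: "set_pmf q \<subseteq> U" by (auto simp: set_pmf_eq pmf_q)
  \<comment> \<open>This bound serves twice: where \<open>pmf q u\<close> is zero it forces the
    coefficients to vanish, as admissibility requires, and elsewhere it bounds the estimator by
    \<open>L\<close>.\<close>
  have dom: "\<bar>\<alpha> u b\<bar> \<le> L * pmf q u" if "u \<in> U" "b \<in> B u" for u b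
    using le_m[OF that] that \<open>L > 0\<close> by (simp add: pmf_q)
  then have "\<alpha> u b = 0" if "u \<in> U" "b \<in> B u" "pmf q u = 0" for u b
    using that by fastforce
  then have "admissible U B P Ob q \<alpha>" using unb setq by (auto simp: admissible_def)
  moreover have "worst_variance B P q \<alpha> \<le> ereal (L\<^sup>2)"
    using worst_variance_le_square_bound[OF fam setq] dom setq by blast
  ultimately show ?thesis unfolding L_def by blast
qed

theorem proposition1:
  fixes U :: "'u set" and B :: "'u \<Rightarrow> 'b set"
    and P :: "'u \<Rightarrow> 'b \<Rightarrow> 'n::finite qop" and \<psi> :: "'n qvec"
  assumes "measurement_family U B P"
    and "norm \<psi> = 1"
  shows "(\<forall>\<alpha>. unbiased U B P (ketbra \<psi>) \<alpha> \<longrightarrow>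
            (\<exists>q. admissible U B P (ketbra \<psi>) q \<alpha> \<and>
                 worst_variance B P q \<alpha> \<le> ereal ((L_cost U B \<alpha>)\<^sup>2))) \<and>
         Gamma_star U B P (ketbra \<psi>)
           \<le> (INF \<alpha>\<in>{\<alpha>. unbiased U B P (ketbra \<psi>) \<alpha>}. ereal ((L_cost U B \<alpha>)\<^sup>2))"
proof -
  have "ketbra \<psi> \<noteq> 0" using assms(2) by (intro ketbra_nonzero) auto
  note ex = exists_admissible_worst_variance_le[OF assms(1) _ this]
  have "Gamma_star U B P (ketbra \<psi>) \<le> ereal ((L_cost U B \<alpha>)\<^sup>2)"
    if unb: "unbiased U B P (ketbra \<psi>) \<alpha>" for \<alpha>
  proof -
    obtain q where q: "admissible U B P (ketbra \<psi>) q \<alpha>"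
      "worst_variance B P q \<alpha> \<le> ereal ((L_cost U B \<alpha>)\<^sup>2)"
      using ex[OF unb] by blast
    then show ?thesis
      unfolding Gamma_star_def by (intro INF_lower2[of "(q, \<alpha>)"]) auto
  qed
  \<comment> \<open>If no coefficient family is unbiased, the right-hand infimum is infinite, and
    \<open>INF_greatest\<close> covers this case too.\<close>
  then show ?thesis using ex by (auto intro: INF_greatest)
qed

end
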